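(* The backward coverability algorithm terminates after at most $n^{2^{O(d)}}$ iterations on $d$-dimensional invertible affine nets encoded in unary, for $d\ge 2$, where $n$ is the input size.
   Context: A $d$-dimensional affine net is a finite set $\mathcal{N}$ of triples $(a,A,b)\in\mathbb{N}^d\times\mathbb{N}^{d\times d}\times\mathbb{N}^d$, with transitions $u\to A\cdot(u-a)+b$ for $u\in\mathbb{N}^d$, $(a,A,b)\in\mathcal{N}$ with $u-a\in\mathbb{N}^d$; it is invertible if each such $A$ is invertible over $\mathbb{Q}$. With componentwise order $\sqsubseteq$ and upward closure ${\uparrow}$, the backward coverability algorithm for target $t\in\mathbb{N}^d$ computes $U_0={\uparrow}\{t\}$ and $U_{k+1}=U_k\cup\mathrm{Pre}_\exists(U_k)$ with $\mathrm{Pre}_\exists(S)=\{x:\exists y\in S,\ x\to y\}$; the number of iterations is the least $\ell$ with $U_\ell=U_{\ell+1}$. The input $(\mathcal{N},t)$ is encoded in unary with size $n$. *)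

theory Defs
  imports "HOL-Library.Landau_Symbols" "Jordan_Normal_Form.Matrix"
begin

text \<open>The dimension \<open>d\<close> is a parameter of the bound, so vectors and matrices are those of
  \<open>Jordan_Normal_Form\<close>, with carriers. On \<open>vec\<close>, \<open>\<le>\<close> is the componentwise order
  (between vectors of equal dimension).\<close>

type_synonym net = "(nat vec \<times> nat mat \<times> nat vec) set"

definition affine_net :: "nat \<Rightarrow> net \<Rightarrow> bool" where
  "affine_net d N \<longleftrightarrow> finite N \<and> N \<subseteq> carrier_vec d \<times> carrier_mat d d \<times> carrier_vec d"

definition invertible_net :: "net \<Rightarrow> bool" where
  "invertible_net N \<longleftrightarrow> (\<forall>(a, A, b) \<in> N. invertible_mat (map_mat rat_of_nat A))"

text \<open>The guard \<open>a \<le> u\<close> says that \<open>u - a\<close> has natural entries; subtraction on \<open>nat\<close> is then exact.\<close>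

definition net_step :: "net \<Rightarrow> nat vec \<Rightarrow> nat vec \<Rightarrow> bool" where
  "net_step N u v \<longleftrightarrow> (\<exists>(a, A, b) \<in> N. a \<le> u \<and> v = A *\<^sub>v (u - a) + b)"

definition up_closure :: "nat \<Rightarrow> nat vec set \<Rightarrow> nat vec set" where
  "up_closure d S = {x \<in> carrier_vec d. \<exists>s \<in> S. s \<le> x}"

definition pre_exists :: "nat \<Rightarrow> net \<Rightarrow> nat vec set \<Rightarrow> nat vec set" where
  "pre_exists d N S = {x \<in> carrier_vec d. \<exists>y \<in> S. net_step N x y}"

fun backward_cov :: "nat \<Rightarrow> net \<Rightarrow> nat vec \<Rightarrow> nat \<Rightarrow> nat vec set" where
  "backward_cov d N t 0 = up_closure d {t}"
| "backward_cov d N t (Suc k) =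
     backward_cov d N t k \<union> pre_exists d N (backward_cov d N t k)"

definition backward_cov_terminates :: "nat \<Rightarrow> net \<Rightarrow> nat vec \<Rightarrow> bool" where
  "backward_cov_terminates d N t \<longleftrightarrow>
     (\<exists>l. backward_cov d N t l = backward_cov d N t (Suc l))"

text \<open>Meaningful only together with \<open>backward_cov_terminates\<close>.\<close>

definition backward_cov_iterations :: "nat \<Rightarrow> net \<Rightarrow> nat vec \<Rightarrow> nat" where
  "backward_cov_iterations d N t =
     (LEAST l. backward_cov d N t l = backward_cov d N t (Suc l))"

text \<open>Unary encoding: a number \<open>k\<close> is written as \<open>k\<close> strokes followed by a delimiter,
  hence has length \<open>k + 1\<close>.\<close>

definition unary_size_vec :: "nat vec \<Rightarrow> nat" where
  "unary_size_vec v = (\<Sum>i < dim_vec v. v $ i + 1)"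

definition unary_size_mat :: "nat mat \<Rightarrow> nat" where
  "unary_size_mat A = (\<Sum>i < dim_row A. \<Sum>j < dim_col A. A $$ (i, j) + 1)"

definition unary_size :: "net \<Rightarrow> nat vec \<Rightarrow> nat" where
  "unary_size N t =
     (\<Sum>(a, A, b) \<in> N. unary_size_vec a + unary_size_mat A + unary_size_vec b) + unary_size_vec t"

end

theory Submission
  imports Defs "Jordan_Normal_Form.Determinant" "HOL-Library.Extended_Nat"
begin

text \<open>The complements of the sets \<open>U\<^sub>k\<close> form a descending chain of downward closed sets, which
  are described by the order ideals they contain, i.e. by vectors over \<open>enat\<close>. Any ideal that
  is lost in step \<open>k + 1\<close> has a post-image lost in step \<open>k\<close>. For an invertible matrix the
  post-image has at least as many infinite components: a non-vanishing term of the determinant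
  maps the infinite components injectively to infinite components.

  So once no ideal with at least \<open>j\<close> infinite components is lost any more, this remains true
  forever. A maximal ideal of a later set then has fewer than \<open>j\<close> components above the bound of
  that moment, since otherwise these components could be pumped to infinity. Hence the maximal
  ideals with exactly \<open>i\<close> infinite components lost after this has happened for all \<open>j > i\<close>
  are thin: the \<open>j\<close>-th largest component is less than the \<open>j\<close>-th bound. There are at most
  \<open>\<Prod>j>i. j * b j\<close> such ideals, and each is lost only once. As the bounds grow linearly in \<open>k\<close>,
  the resulting recurrence roughly squares the length from one level to the next.\<close>

section \<open>Thin ideals\<close>

definition omegas :: "nat \<Rightarrow> (nat \<Rightarrow> enat) \<Rightarrow> nat" where
  "omegas d u = card {i \<in> {..<d}. u i = \<infinity>}"

text \<open>The last condition says that the \<open>j\<close>-th largest component on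
  \<open>S\<close> is below \<open>b j\<close>. The index set \<open>S\<close> is a parameter so
  that coordinates can be removed one by one when such vectors are counted.\<close>

definition thin :: "nat \<Rightarrow> (nat \<Rightarrow> nat) \<Rightarrow> nat set \<Rightarrow> (nat \<Rightarrow> enat) set" where
  "thin i b S = {u. (\<forall>c. c \<notin> S \<longrightarrow> u c = 0) \<and> card {c \<in> S. u c = \<infinity>} = i \<and>
     (\<forall>j. i < j \<and> j \<le> card S \<longrightarrow> card {c \<in> S. enat (b j) \<le> u c} < j)}"

text \<open>Thinness for \<open>j = card S\<close> forbids that all components reach
  \<open>b (card S)\<close>, so some component is smaller and in particular finite. Deleting it
  keeps the infinite ones and can only lower the counts for smaller \<open>j\<close>.\<close>

lemma thin_remove:
  assumes S: "finite S" "card S = Suc m" "i \<le> m" and u: "u \<in> thin i b S"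
  obtains c x v where "c \<in> S" "x < b (Suc m)" "v \<in> thin i b (S - {c})" "u = v(c := enat x)"
proof -
  have "card {c \<in> S. enat (b (Suc m)) \<le> u c} < card S"
    using u S unfolding thin_def by auto
  then have "{c \<in> S. enat (b (Suc m)) \<le> u c} \<noteq> S" by auto
  then obtain c where c: "c \<in> S" "u c < enat (b (Suc m))" using not_le by blast
  then obtain x where x: "u c = enat x" "x < b (Suc m)" by (cases "u c") auto
  define v where "v = u(c := 0)"
  have inf: "{c' \<in> S - {c}. v c' = \<infinity>} = {c' \<in> S. u c' = \<infinity>}"
    using x by (auto simp: v_def)
  have "card {c' \<in> S - {c}. enat (b j) \<le> v c'} < j" if j: "i < j" "j \<le> m" for j
  proof -
    have "card {c' \<in> S - {c}. enat (b j) \<le> v c'} \<le> card {c' \<in> S. enat (b j) \<le> u c'}"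
      using S by (intro card_mono) (auto simp: v_def)
    also have "\<dots> < j" using u j S unfolding thin_def by auto
    finally show ?thesis .
  qed
  moreover have "\<forall>c'. c' \<notin> S - {c} \<longrightarrow> v c' = 0" using u by (auto simp: v_def thin_def)
  ultimately have "v \<in> thin i b (S - {c})"
    using u inf S c by (simp add: thin_def)
  moreover have "u = v(c := enat x)" using x by (auto simp: v_def)
  ultimately show ?thesis using that c(1) x(2) by blast
qed

text \<open>Induction on \<open>card S\<close>, deleting a small component: its position contributes
  the factor \<open>Suc m\<close>, its value the factor \<open>b (Suc m)\<close>. If
  \<open>i = card S\<close>, all components are infinite and at most one vector remains.\<close>

lemma card_thin:
  assumes "finite S" "card S = m" "i \<le> m"
  shows "finite (thin i b S) \<and> card (thin i b S) \<le> (\<Prod>j\<in>{i<..m}. j * b j)"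
  using assms
proof (induction m arbitrary: S)
  case base: 0
  then have "thin i b S \<subseteq> {\<lambda>c. 0}" by (auto simp: thin_def)
  then have "finite (thin i b S)" "card (thin i b S) \<le> 1"
    using finite_subset card_mono[of "{\<lambda>c. 0 :: enat}"] by auto
  then show ?case by simp
next
  case (Suc m)
  show ?case
  proof (cases "i = Suc m")
    case True
    have "u = (\<lambda>c. if c \<in> S then \<infinity> else 0)" if "u \<in> thin i b S" for u
    proof -
      have "{c \<in> S. u c = \<infinity>} = S"
        using that Suc.prems True by (intro card_subset_eq) (auto simp: thin_def)
      then show ?thesis using that by (auto simp: thin_def fun_eq_iff)
    qed
    then have "thin i b S \<subseteq> {\<lambda>c. if c \<in> S then \<infinity> else 0}" by auto
    then have "finite (thin i b S)" "card (thin i b S) \<le> 1"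
      using finite_subset card_mono[of "{\<lambda>c. if c \<in> S then \<infinity> else 0 :: enat}"] by auto
    then show ?thesis using True by simp
  next
    case False
    then have i: "i \<le> m" using Suc.prems by simp
    let ?X = "\<lambda>c. {..<b (Suc m)} \<times> thin i b (S - {c})"
    let ?g = "\<lambda>c (x, v). v(c := enat x)"
    let ?P = "\<Prod>j\<in>{i<..m}. j * b j"
    have IH: "finite (thin i b (S - {c}))" "card (thin i b (S - {c})) \<le> ?P" if "c \<in> S" for c
      using Suc.IH[of "S - {c}"] that Suc.prems i by auto
    have sub: "thin i b S \<subseteq> (\<Union>c\<in>S. ?g c ` ?X c)"
    proof
      fix u assume "u \<in> thin i b S"
      from thin_remove[OF Suc.prems(1,2) i this] obtain c x v
        where "c \<in> S" "x < b (Suc m)" "v \<in> thin i b (S - {c})" "u = v(c := enat x)" .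
      then show "u \<in> (\<Union>c\<in>S. ?g c ` ?X c)" by force
    qed
    have fin: "finite (\<Union>c\<in>S. ?g c ` ?X c)" using IH Suc.prems by auto
    have "card (?g c ` ?X c) \<le> b (Suc m) * ?P" if "c \<in> S" for c
    proof -
      have "card (?g c ` ?X c) \<le> card (?X c)" using IH[OF that] by (intro card_image_le) auto
      also have "\<dots> \<le> b (Suc m) * ?P" using IH[OF that] by (simp add: card_cartesian_product)
      finally show ?thesis .
    qed
    then have "(\<Sum>c\<in>S. card (?g c ` ?X c)) \<le> card S * (b (Suc m) * ?P)"
      using sum_bounded_above[of S "\<lambda>c. card (?g c ` ?X c)" "b (Suc m) * ?P"] by simp
    moreover have "card (\<Union>c\<in>S. ?g c ` ?X c) \<le> (\<Sum>c\<in>S. card (?g c ` ?X c))"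
      using Suc.prems(1) by (rule card_UN_le)
    moreover have "card (thin i b S) \<le> card (\<Union>c\<in>S. ?g c ` ?X c)"
      using card_mono[OF fin sub] .
    moreover have "(\<Prod>j\<in>{i<..Suc m}. j * b j) = card S * (b (Suc m) * ?P)"
    proof -
      have "{i<..Suc m} = insert (Suc m) {i<..m}" using i by auto
      then show ?thesis using Suc.prems(2) by (simp add: algebra_simps)
    qed
    ultimately show ?thesis
      using finite_subset[OF sub fin] by linarith
  qed
qed

section \<open>Strongly monotone descending chains\<close>

text \<open>\<open>E k\<close> models the ideals inside the complement of the \<open>k\<close>-th
  set, and \<open>B k\<close> bounds the entries of the minimal elements of that set, whence
  \<open>pump\<close>. That the set is nonempty becomes \<open>omegas_less\<close>.\<close>

locale strongly_monotone_chain =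
  fixes d :: nat and E :: "nat \<Rightarrow> (nat \<Rightarrow> enat) set" and B :: "nat \<Rightarrow> nat"
  assumes support: "u \<in> E k \<Longrightarrow> d \<le> i \<Longrightarrow> u i = 0"
    and decreasing: "E (Suc k) \<subseteq> E k"
    and down: "v \<in> E k \<Longrightarrow> u \<le> v \<Longrightarrow> u \<in> E k"
    and pump: "u \<in> E k \<Longrightarrow> (\<lambda>i. if i < d \<and> enat (B k) \<le> u i then \<infinity> else u i) \<in> E k"
    and omegas_less: "u \<in> E k \<Longrightarrow> omegas d u < d"
    and strong_mono: "u \<in> E (Suc k) \<Longrightarrow> u \<notin> E (Suc (Suc k)) \<Longrightarrow>
      \<exists>v. v \<in> E k \<and> v \<notin> E (Suc k) \<and> omegas d u \<le> omegas d v"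
begin

lemma antimono: "k \<le> l \<Longrightarrow> E l \<subseteq> E k"
  using lift_Suc_antimono_le[of E k l] decreasing by blast

lemma omegas_mono: "u \<le> v \<Longrightarrow> omegas d u \<le> omegas d v"
  unfolding omegas_def by (rule card_mono) (auto simp: le_fun_def, metis enat_ord_simps(5))

text \<open>Traces a loss back in time, so that every step from \<open>k\<close> to \<open>l\<close>
  supplies a lost ideal for the pigeonhole argument in \<open>length_bound\<close>.\<close>

lemma strong_mono_le:
  assumes "u \<in> E l" "u \<notin> E (Suc l)" "k \<le> l"
  shows "\<exists>v. v \<in> E k \<and> v \<notin> E (Suc k) \<and> omegas d u \<le> omegas d v"
  using assms(3)
proof (induction rule: inc_induct)
  case base
  then show ?case using assms by auto
next
  case (step k)
  then show ?case using strong_mono by (meson order_trans)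
qed

text \<open>Pumping puts every member of \<open>E k\<close> below one with entries in a finite set,
  where maximal elements exist. Such an element is maximal in all of \<open>E k\<close>, since
  anything above it can be pumped back into the finite set.\<close>

lemma maximal_above:
  assumes "u \<in> E k"
  obtains m where "m \<in> E k" "u \<le> m" "\<And>v. v \<in> E k \<Longrightarrow> m \<le> v \<Longrightarrow> v = m"
proof -
  let ?p = "\<lambda>u i. if i < d \<and> enat (B k) \<le> u i then \<infinity> else u i"
  let ?V = "insert \<infinity> (enat ` {..B k})"
  let ?F = "{v. (\<forall>i. (i \<in> {..<d} \<longrightarrow> v i \<in> ?V) \<and> (i \<notin> {..<d} \<longrightarrow> v i = 0))} \<inter> E k"
  have F: "?p v \<in> ?F" "v \<le> ?p v" if v: "v \<in> E k" for v
  proof -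
    have "?p v i \<in> ?V" if "i < d" for i using that by (cases "v i") auto
    moreover have "?p v i = 0" if "\<not> i < d" for i using support[OF v, of i] that by simp
    ultimately have "\<forall>i. (i \<in> {..<d} \<longrightarrow> ?p v i \<in> ?V) \<and> (i \<notin> {..<d} \<longrightarrow> ?p v i = 0)"
      unfolding lessThan_iff by blast
    then show "?p v \<in> ?F" using pump[OF v] by blast
    show "v \<le> ?p v" by (simp add: le_fun_def)
  qed
  have "finite ?F" by (intro finite_Int disjI1 finite_set_of_finite_funs) auto
  from finite_has_maximal2[OF this F(1)[OF assms]] obtain m
    where m: "m \<in> ?F" "?p u \<le> m" "\<forall>v\<in>?F. m \<le> v \<longrightarrow> m = v" by blast
  have "v = m" if v: "v \<in> E k" "m \<le> v" for v
  proof -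
    have "m \<le> ?p v" using F(2)[OF v(1)] v(2) by (rule order_trans[rotated])
    then have "m = ?p v" using m(3) F(1)[OF v(1)] by blast
    then show ?thesis using F(2)[OF v(1)] v(2) by (metis order_antisym)
  qed
  moreover have "u \<le> m" using F(2)[OF assms] m(2) by (rule order_trans)
  ultimately show ?thesis using that m(1) by blast
qed

text \<open>\<open>L i\<close> is a time from which on no ideal with at least \<open>i\<close>
  infinite components is lost. The induction descends from \<open>i = d\<close>; a later loss with
  \<open>i\<close> infinite components would require more distinct thin ideals than there
  are.\<close>

theorem length_bound:
  assumes L: "\<And>i. i < d \<Longrightarrow> L (Suc i) + (\<Prod>j\<in>{i<..d}. j * B (L j)) \<le> L i"
    and "i \<le> d" "L i \<le> k" "u \<in> E k" "u \<notin> E (Suc k)"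
  shows "omegas d u < i"
  using assms(2-)
proof (induction "d - i" arbitrary: i k u rule: less_induct)
  case less
  have L_mono: "L j \<le> L i" if "i \<le> j" "j \<le> d" for i j
    using that
  proof (induction rule: inc_induct)
    case (step n)
    then show ?case using L[of n] by simp
  qed simp
  show ?case
  proof (cases "i = d")
    case True
    then show ?thesis using omegas_less less.prems by blast
  next
    case False
    then have i: "i < d" using less.prems by simp
    have IH: "omegas d v < j"
      if "i < j" "j \<le> d" "L j \<le> l" "v \<in> E l" "v \<notin> E (Suc l)" for j l v
      using less.hyps[of j l v] that i by simp
    show ?thesis
    proof (rule ccontr)
      assume ui: "\<not> omegas d u < i"
      let ?T = "thin i (\<lambda>j. B (L j)) {..<d}"
      \<comment> \<open>Both ends are included: as \<open>L i \<le> k\<close>, the interval has at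
        least one element more than the product bounding \<open>card ?T\<close>.\<close>
      let ?K = "{L (Suc i)..k}"
      have "\<exists>m. m \<in> E l \<and> m \<notin> E (Suc l) \<and> m \<in> ?T" if l: "l \<in> ?K" for l
      proof -
        obtain v where v: "v \<in> E l" "v \<notin> E (Suc l)" "omegas d u \<le> omegas d v"
          using strong_mono_le[OF less.prems(3,4), of l] l by auto
        obtain m where m: "m \<in> E l" "v \<le> m" "\<And>w. w \<in> E l \<Longrightarrow> m \<le> w \<Longrightarrow> w = m"
          using maximal_above[OF v(1)] by metis
        have m': "m \<notin> E (Suc l)" using v m down by blast
        \<comment> \<open>At least \<open>i\<close> because \<open>v \<le> m\<close>; at most
          \<open>i\<close> because ideals with \<open>Suc i\<close> infinite components are no
          longer lost from \<open>L (Suc i)\<close> on.\<close>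
        have om: "omegas d m = i"
          using IH[of "Suc i" l m] m m' l i ui v(3) omegas_mono[OF m(2)] by auto
        have "card {c \<in> {..<d}. enat (B (L j)) \<le> m c} < j" if j: "i < j" "j \<le> d" for j
        proof (rule ccontr)
          assume big: "\<not> ?thesis"
          \<comment> \<open>Pump \<open>m\<close> at the earlier time \<open>L j\<close>. The result
            has at least \<open>j\<close> infinite components, so it is never lost afterwards and
            still lies in \<open>E l\<close>, against the maximality of \<open>m\<close>.\<close>
          define w where "w = (\<lambda>c. if c < d \<and> enat (B (L j)) \<le> m c then \<infinity> else m c)"
          have lj: "L j \<le> l" using L_mono[of "Suc i" j] j l by simp
          then have "m \<in> E (L j)" using antimono m(1) by blast
          then have w: "w \<in> E (L j)" unfolding w_def by (rule pump)
          have "card {c \<in> {..<d}. enat (B (L j)) \<le> m c} \<le> omegas d w"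
            unfolding omegas_def by (rule card_mono) (auto simp: w_def)
          then have wj: "j \<le> omegas d w" using big by simp
          have "w \<in> E l" using lj
          proof (induction l rule: dec_induct)
            case (step n)
            then show ?case using IH[OF j step(1) step(3)] wj by (meson not_le)
          qed (rule w)
          moreover have "m \<le> w" by (simp add: w_def le_fun_def)
          ultimately have "w = m" using m(3) by blast
          then show False using om wj j by simp
        qed
        then have "m \<in> ?T"
          using om support[OF m(1)] by (auto simp: thin_def omegas_def)
        then show ?thesis using m m' by blast
      qed
      then obtain m where m: "\<And>l. l \<in> ?K \<Longrightarrow> m l \<in> E l \<and> m l \<notin> E (Suc l) \<and> m l \<in> ?T"
        by metis
      \<comment> \<open>An ideal lost at step \<open>l\<close> is missing from all later
        sets.\<close>
      have neq: "m l \<noteq> m l'" if "l \<in> ?K" "l' \<in> ?K" "l < l'" for l l'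
        using m[OF that(1)] m[OF that(2)] antimono[of "Suc l" l'] that(3) by auto
      have "inj_on m ?K" by (rule linorder_inj_onI) (auto simp: neq)
      then have "card ?K \<le> card ?T"
        using m card_thin[of "{..<d}" d i] i by (intro card_inj_on_le) auto
      also have "\<dots> \<le> (\<Prod>j\<in>{i<..d}. j * B (L j))"
        using card_thin[of "{..<d}" d i] i by auto
      finally show False using L[OF i] less.prems(2) by simp
    qed
  qed
qed

end


section \<open>Ideals and affine transitions\<close>

text \<open>A function \<open>u\<close> stands for the ideal of all vectors below it, and the second
  condition says that this ideal is disjoint from \<open>U\<close>. Zeros from \<open>d\<close> on
  give each ideal a single representative.\<close>

definition avoiding :: "nat \<Rightarrow> nat vec set \<Rightarrow> (nat \<Rightarrow> enat) set" where
  "avoiding d U = {u. (\<forall>i\<ge>d. u i = 0) \<and> (\<forall>x\<in>U. \<exists>i<d. u i < enat (x $ i))}"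

lemma avoiding_support: "u \<in> avoiding d U \<Longrightarrow> d \<le> i \<Longrightarrow> u i = 0"
  unfolding avoiding_def by blast

lemma not_avoidingI:
  assumes "x \<in> U" "\<And>i. i < d \<Longrightarrow> enat (x $ i) \<le> u i"
  shows "u \<notin> avoiding d U"
proof
  assume "u \<in> avoiding d U"
  then obtain i where "i < d" "u i < enat (x $ i)" using assms(1) unfolding avoiding_def by blast
  then show False using assms(2)[of i] by simp
qed

lemma omegas_avoiding_less:
  assumes "u \<in> avoiding d U" "x \<in> U"
  shows "omegas d u < d"
proof -
  obtain i where i: "i < d" "u i < enat (x $ i)" using assms unfolding avoiding_def by blast
  then have "i \<notin> {i \<in> {..<d}. u i = \<infinity>}" "i \<in> {..<d}" using enat_iless[OF i(2)] by auto
  moreover have "{i \<in> {..<d}. u i = \<infinity>} \<subseteq> {..<d}" by (rule Collect_restrict)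
  ultimately have "{i \<in> {..<d}. u i = \<infinity>} \<subset> {..<d}" by (metis psubsetI)
  then have "card {i \<in> {..<d}. u i = \<infinity>} < card {..<d}"
    by (intro psubset_card_mono) auto
  then show ?thesis unfolding omegas_def card_lessThan .
qed

text \<open>For \<open>u\<close> above \<open>a\<close>, this is the ideal generated by the images
  of the vectors below \<open>u\<close> that satisfy the guard. The rule
  \<open>0 * \<infinity> = 0\<close> of \<open>enat\<close> lets a zero coefficient ignore an
  infinite component.\<close>

definition ideal_post ::
    "nat \<Rightarrow> nat vec \<Rightarrow> nat mat \<Rightarrow> nat vec \<Rightarrow> (nat \<Rightarrow> enat) \<Rightarrow> nat \<Rightarrow> enat" where
  "ideal_post d a A b u i =
     (if i < d then (\<Sum>j<d. enat (A $$ (i, j)) * (u j - enat (a $ j))) + enat (b $ i) else 0)"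

lemma enat_sum: "enat (sum f S) = (\<Sum>j\<in>S. enat (f j))"
  by (simp flip: of_nat_eq_enat)

context
  fixes d :: nat and a :: "nat vec" and A :: "nat mat" and b :: "nat vec"
  assumes carrier: "a \<in> carrier_vec d" "A \<in> carrier_mat d d" "b \<in> carrier_vec d"
begin

lemma affine_index:
  assumes "x \<in> carrier_vec d" "i < d"
  shows "(A *\<^sub>v (x - a) + b) $ i = (\<Sum>j<d. A $$ (i, j) * (x $ j - a $ j)) + b $ i"
  using carrier assms by (simp add: scalar_prod_def lessThan_atLeast0)

lemma affine_mono:
  assumes "x \<in> carrier_vec d" "y \<in> carrier_vec d" "x \<le> y"
  shows "A *\<^sub>v (x - a) + b \<le> A *\<^sub>v (y - a) + b"
proof -
  have "(A *\<^sub>v (x - a) + b) $ i \<le> (A *\<^sub>v (y - a) + b) $ i" if i: "i < d" for i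
    unfolding affine_index[OF assms(1) i] affine_index[OF assms(2) i] using assms
    by (intro add_right_mono sum_mono mult_left_mono diff_le_mono) (auto simp: less_eq_vec_def)
  then show ?thesis using carrier assms by (simp add: less_eq_vec_def)
qed

lemma affine_le_ideal_post:
  assumes "x \<in> carrier_vec d" "\<And>j. j < d \<Longrightarrow> enat (x $ j) \<le> u j" "i < d"
  shows "enat ((A *\<^sub>v (x - a) + b) $ i) \<le> ideal_post d a A b u i"
proof -
  have "enat (A $$ (i, j) * (x $ j - a $ j)) \<le> enat (A $$ (i, j)) * (u j - enat (a $ j))"
    if "j < d" for j
  proof (cases "u j")
    case (enat n)
    then show ?thesis using assms(2)[OF that] by (simp add: diff_le_mono)
  qed (cases "A $$ (i, j) = 0"; simp add: zero_enat_def[symmetric] imult_is_infinity)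
  then have "enat (\<Sum>j<d. A $$ (i, j) * (x $ j - a $ j)) \<le>
      (\<Sum>j<d. enat (A $$ (i, j)) * (u j - enat (a $ j)))"
    unfolding enat_sum by (intro sum_mono) auto
  then show ?thesis
    unfolding affine_index[OF assms(1,3)] ideal_post_def using assms(3)
    by (simp add: add_right_mono flip: plus_enat_simps(1))
qed

lemma ideal_post_infinity:
  assumes "i < d" "j < d" "A $$ (i, j) \<noteq> 0" "u j = \<infinity>"
  shows "ideal_post d a A b u i = \<infinity>"
proof -
  let ?f = "\<lambda>j. enat (A $$ (i, j)) * (u j - enat (a $ j))"
  have "?f j = \<infinity>" using assms by (simp add: imult_is_infinity zero_enat_def)
  moreover have "?f j \<le> sum ?f {..<d}" using assms by (intro member_le_sum) auto
  ultimately show ?thesis using assms(1) by (simp add: ideal_post_def)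
qed

text \<open>Replace each infinite component of \<open>u\<close> by \<open>a $ j + M\<close>, where
  \<open>M\<close> dominates every entry of \<open>y\<close>. A row with a nonzero coefficient there
  reaches \<open>M\<close>; every other row attains the value of \<open>ideal_post\<close>
  exactly.\<close>

lemma below_ideal_post:
  assumes u: "\<And>j. j < d \<Longrightarrow> enat (a $ j) \<le> u j"
    and y: "y \<in> carrier_vec d" "\<And>i. i < d \<Longrightarrow> enat (y $ i) \<le> ideal_post d a A b u i"
  obtains x where "x \<in> carrier_vec d" "a \<le> x" "\<And>j. j < d \<Longrightarrow> enat (x $ j) \<le> u j"
    "y \<le> A *\<^sub>v (x - a) + b"
proof -
  define M where "M = (\<Sum>i<d. y $ i)"
  define x where "x = vec d (\<lambda>j. case u j of enat n \<Rightarrow> n | \<infinity> \<Rightarrow> a $ j + M)"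
  have x: "x \<in> carrier_vec d" by (simp add: x_def)
  have xu: "enat (x $ j) \<le> u j" if "j < d" for j
    using that by (simp add: x_def split: enat.split)
  have ax: "a $ j \<le> x $ j" if "j < d" for j
    using u[OF that] that by (auto simp: x_def split: enat.split)
  have "y $ i \<le> (A *\<^sub>v (x - a) + b) $ i" if i: "i < d" for i
  proof (cases "\<exists>j<d. A $$ (i, j) \<noteq> 0 \<and> u j = \<infinity>")
    case True
    then obtain j where j: "j < d" "A $$ (i, j) \<noteq> 0" "u j = \<infinity>" by blast
    have "y $ i \<le> M" unfolding M_def using i by (intro member_le_sum) auto
    also have "M \<le> A $$ (i, j) * (x $ j - a $ j)" using j by (simp add: x_def)
    also have "\<dots> \<le> (\<Sum>j<d. A $$ (i, j) * (x $ j - a $ j))"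
      using j by (intro member_le_sum) auto
    finally show ?thesis unfolding affine_index[OF x i] by simp
  next
    case False
    have "enat (A $$ (i, j)) * (u j - enat (a $ j)) = enat (A $$ (i, j) * (x $ j - a $ j))"
      if "j < d" for j
      using that False by (cases "u j") (auto simp: x_def zero_enat_def[symmetric])
    then have "ideal_post d a A b u i = enat ((A *\<^sub>v (x - a) + b) $ i)"
      unfolding affine_index[OF x i] ideal_post_def using i by (simp add: enat_sum flip: plus_enat_simps(1))
    then show ?thesis using y(2)[OF i] by simp
  qed
  then have "y \<le> A *\<^sub>v (x - a) + b"
    using carrier y(1) x by (simp add: less_eq_vec_def)
  moreover have "a \<le> x" using ax carrier x by (simp add: less_eq_vec_def)
  ultimately show ?thesis using that x xu by blast
qed

text \<open>The Leibniz formula for the nonzero determinant yields a permutation \<open>p\<close>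
  with all \<open>A $$ (i, p i)\<close> nonzero, so an infinite component at \<open>p i\<close>
  forces one at \<open>i\<close>.\<close>

lemma omegas_ideal_post:
  assumes "invertible_mat (map_mat rat_of_nat A)"
  shows "omegas d u \<le> omegas d (ideal_post d a A b u)"
proof -
  let ?A = "map_mat rat_of_nat A"
  have A: "?A \<in> carrier_mat d d" using carrier by simp
  from assms obtain C where C: "?A * C = 1\<^sub>m d" "C * ?A = 1\<^sub>m (dim_row C)"
    using A unfolding invertible_mat_def inverts_mat_def by auto
  \<comment> \<open>\<open>invertible_mat\<close> does not state the dimensions of \<open>C\<close>;
    they are read off the two products.\<close>
  have "dim_col (?A * C) = d" "dim_col (C * ?A) = dim_row C" unfolding C by simp_all
  then have "C \<in> carrier_mat d d" using A by auto
  from det_mult[OF A this] C(1) have "det ?A \<noteq> 0" by auto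
  then obtain p where p: "p permutes {0..<d}"
    and "signof p * (\<Prod>i=0..<d. ?A $$ (i, p i)) \<noteq> 0"
    unfolding det_def'[OF A] by (auto elim!: sum.not_neutral_contains_not_neutral)
  then have "\<forall>i<d. ?A $$ (i, p i) \<noteq> 0" by auto
  moreover have "p i < d" if "i < d" for i using permutes_in_image[OF p, of i] that by simp
  ultimately have nz: "A $$ (i, p i) \<noteq> 0" "p i < d" if "i < d" for i
    using that carrier by auto
  have "{j \<in> {..<d}. u j = \<infinity>} \<subseteq> p ` {i \<in> {..<d}. ideal_post d a A b u i = \<infinity>}"
  proof
    fix j assume j: "j \<in> {j \<in> {..<d}. u j = \<infinity>}"
    then obtain i where i: "i < d" "j = p i"
      using permutes_image[OF p] by (metis (lifting) atLeast0LessThan imageE lessThan_iff mem_Collect_eq)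
    then show "j \<in> p ` {i \<in> {..<d}. ideal_post d a A b u i = \<infinity>}"
      using ideal_post_infinity[of i j u] nz[of i] j by auto
  qed
  then show ?thesis unfolding omegas_def by (intro surj_card_le) auto
qed

text \<open>A row with a nonzero coefficient at a shortened coordinate still yields at least
  \<open>m\<close>, because the guard takes away at most \<open>c\<close>; the other rows do not
  change.\<close>

lemma affine_truncate:
  fixes m c :: nat
  assumes x: "x \<in> carrier_vec d" "a \<le> x" and c: "\<And>j. j < d \<Longrightarrow> a $ j \<le> c"
  defines "x' \<equiv> vec d (\<lambda>i. min (x $ i) (m + c))"
  shows "a \<le> x'" "vec d (\<lambda>i. min ((A *\<^sub>v (x - a) + b) $ i) m) \<le> A *\<^sub>v (x' - a) + b"
proof -
  have x': "x' \<in> carrier_vec d" by (simp add: x'_def)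
  show "a \<le> x'" using x carrier c by (fastforce simp: x'_def less_eq_vec_def)
  have "min ((A *\<^sub>v (x - a) + b) $ i) m \<le> (A *\<^sub>v (x' - a) + b) $ i" if i: "i < d" for i
  proof (cases "\<exists>j<d. A $$ (i, j) \<noteq> 0 \<and> m + c < x $ j")
    case True
    then obtain j where j: "j < d" "A $$ (i, j) \<noteq> 0" "m + c < x $ j" by blast
    have "m \<le> x' $ j - a $ j" using j c[OF j(1)] by (simp add: x'_def)
    also have "\<dots> \<le> A $$ (i, j) * (x' $ j - a $ j)" using j by simp
    also have "\<dots> \<le> (\<Sum>j<d. A $$ (i, j) * (x' $ j - a $ j))"
      using j by (intro member_le_sum) auto
    finally show ?thesis unfolding affine_index[OF x' i] by simp
  next
    case False
    then have "A $$ (i, j) * (x $ j - a $ j) = A $$ (i, j) * (x' $ j - a $ j)" if "j < d" for j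
      using that by (auto simp: x'_def)
    then have "(\<Sum>j<d. A $$ (i, j) * (x $ j - a $ j)) = (\<Sum>j<d. A $$ (i, j) * (x' $ j - a $ j))"
      by (intro sum.cong) auto
    then show ?thesis unfolding affine_index[OF x' i] affine_index[OF x(1) i] by simp
  qed
  then show "vec d (\<lambda>i. min ((A *\<^sub>v (x - a) + b) $ i) m) \<le> A *\<^sub>v (x' - a) + b"
    using carrier x' by (simp add: less_eq_vec_def)
qed

end

section \<open>The chain of the backward coverability algorithm\<close>

lemma backward_cov_carrier: "backward_cov d N t k \<subseteq> carrier_vec d"
  by (induction k) (auto simp: up_closure_def pre_exists_def)

lemma target_in_backward_cov: "t \<in> carrier_vec d \<Longrightarrow> t \<in> backward_cov d N t k"
  by (induction k) (simp_all add: up_closure_def)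

lemma net_step_carrier:
  assumes "affine_net d N" "net_step N x y"
  shows "y \<in> carrier_vec d"
proof -
  obtain a A b where "(a, A, b) \<in> N" "y = A *\<^sub>v (x - a) + b"
    using assms(2) unfolding net_step_def by auto
  moreover from this have "A \<in> carrier_mat d d" "b \<in> carrier_vec d"
    using assms(1) by (auto simp: affine_net_def)
  ultimately show ?thesis by (metis add_carrier_vec carrier_matD(1) carrier_vec_dim_vec dim_mult_mat_vec)
qed

lemma net_step_mono:
  assumes "affine_net d N" "x \<in> carrier_vec d" "x' \<in> carrier_vec d" "x \<le> x'" "net_step N x y"
  shows "\<exists>y'. net_step N x' y' \<and> y \<le> y'"
proof -
  from assms(5) obtain a A b where aAb: "(a, A, b) \<in> N" "a \<le> x" "y = A *\<^sub>v (x - a) + b"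
    unfolding net_step_def by auto
  have "a \<le> x'" using aAb(2) assms(4) by (rule order_trans)
  moreover have "y \<le> A *\<^sub>v (x' - a) + b"
    unfolding aAb(3) using aAb(1) assms(1-4) by (intro affine_mono) (auto simp: affine_net_def)
  ultimately show ?thesis using aAb(1) unfolding net_step_def by blast
qed

lemma backward_cov_upward:
  assumes "affine_net d N" "x \<in> backward_cov d N t k" "x \<le> y" "y \<in> carrier_vec d"
  shows "y \<in> backward_cov d N t k"
  using assms(2-)
proof (induction k arbitrary: x y)
  case 0
  then show ?case by (auto simp: up_closure_def intro: order_trans)
next
  case (Suc k)
  show ?case
  proof (cases "x \<in> backward_cov d N t k")
    case True
    then show ?thesis using Suc by auto
  next
    case False
    then obtain z where z: "x \<in> carrier_vec d" "z \<in> backward_cov d N t k" "net_step N x z"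
      using Suc.prems by (auto simp: pre_exists_def)
    then obtain z' where z': "net_step N y z'" "z \<le> z'"
      using net_step_mono[OF assms(1)] Suc.prems by blast
    then have "z' \<in> backward_cov d N t k"
      using Suc.IH[OF z(2)] net_step_carrier[OF assms(1)] by blast
    then show ?thesis using z' Suc.prems by (auto simp: pre_exists_def)
  qed
qed

text \<open>Equivalently, minimal elements have entries of at most \<open>c * (k + 1)\<close>: the
  target accounts for \<open>c\<close>, and each backward step adds at most \<open>c\<close> by
  \<open>affine_truncate\<close>. This is the source of \<open>pump\<close>.\<close>

lemma backward_cov_truncate:
  assumes "affine_net d N" "t \<in> carrier_vec d"
    and c: "\<And>j. j < d \<Longrightarrow> t $ j \<le> c"
      "\<And>a A b j. (a, A, b) \<in> N \<Longrightarrow> j < d \<Longrightarrow> a $ j \<le> c"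
    and "x \<in> backward_cov d N t k"
  shows "vec d (\<lambda>i. min (x $ i) (c * (k + 1))) \<in> backward_cov d N t k"
  using assms(5)
proof (induction k arbitrary: x)
  case 0
  then show ?case using assms(2) c(1) by (auto simp: up_closure_def less_eq_vec_def)
next
  case (Suc k)
  let ?x = "vec d (\<lambda>i. min (x $ i) (c * (k + 1) + c))"
  have eq: "c * (Suc k + 1) = c * (k + 1) + c" by simp
  show ?case
  proof (cases "x \<in> backward_cov d N t k")
    case True
    have "vec d (\<lambda>i. min (x $ i) (c * (k + 1))) \<le> ?x" by (auto simp: less_eq_vec_def)
    from backward_cov_upward[OF assms(1) Suc.IH[OF True] this]
    show ?thesis unfolding eq by simp
  next
    case False
    then obtain z where z: "x \<in> carrier_vec d" "z \<in> backward_cov d N t k" "net_step N x z"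
      using Suc.prems by (auto simp: pre_exists_def)
    then obtain a A b where aAb: "(a, A, b) \<in> N" "a \<le> x" "z = A *\<^sub>v (x - a) + b"
      unfolding net_step_def by auto
    then have "a \<in> carrier_vec d" "A \<in> carrier_mat d d" "b \<in> carrier_vec d"
      using assms(1) by (auto simp: affine_net_def)
    note tr = affine_truncate[OF this z(1) aAb(2), of c "c * (k + 1)"]
    have step: "net_step N ?x (A *\<^sub>v (?x - a) + b)"
      using tr(1) c(2)[OF aAb(1)] aAb(1) unfolding net_step_def by blast
    have "A *\<^sub>v (?x - a) + b \<in> backward_cov d N t k"
      using backward_cov_upward[OF assms(1) Suc.IH[OF z(2)]] tr(2) c(2)[OF aAb(1)]
        net_step_carrier[OF assms(1) step] unfolding aAb(3) by blast
    then show ?thesis unfolding eq using step by (auto simp: pre_exists_def)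
  qed
qed

lemma avoiding_backward_cov_chain:
  assumes N: "affine_net d N" "invertible_net N" and t: "t \<in> carrier_vec d"
    and c: "\<And>j. j < d \<Longrightarrow> t $ j \<le> c"
      "\<And>a A b j. (a, A, b) \<in> N \<Longrightarrow> j < d \<Longrightarrow> a $ j \<le> c"
  shows "strongly_monotone_chain d (\<lambda>k. avoiding d (backward_cov d N t k)) (\<lambda>k. c * (k + 1))"
proof
  let ?U = "backward_cov d N t"
  fix u v :: "nat \<Rightarrow> enat" and k i :: nat
  show "u \<in> avoiding d (?U k) \<Longrightarrow> d \<le> i \<Longrightarrow> u i = 0" by (rule avoiding_support)
  show "avoiding d (?U (Suc k)) \<subseteq> avoiding d (?U k)"
    unfolding avoiding_def backward_cov.simps(2) by blast
  show "u \<in> avoiding d (?U k)" if v: "v \<in> avoiding d (?U k)" "u \<le> v"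
    unfolding avoiding_def mem_Collect_eq
  proof (intro conjI allI impI ballI)
    fix i assume "d \<le> i"
    then have "v i = 0" by (rule avoiding_support[OF v(1)])
    then show "u i = 0" using le_funD[OF v(2), of i] by simp
  next
    fix x assume "x \<in> ?U k"
    then obtain i where "i < d" "v i < enat (x $ i)"
      using v(1) unfolding avoiding_def by blast
    then show "\<exists>i<d. u i < enat (x $ i)" using le_funD[OF v(2), of i] order_le_less_trans by blast
  qed
  show "(\<lambda>i. if i < d \<and> enat (c * (k + 1)) \<le> u i then \<infinity> else u i) \<in> avoiding d (?U k)"
    if u: "u \<in> avoiding d (?U k)"
    unfolding avoiding_def mem_Collect_eq
  proof (intro conjI allI impI ballI)
    fix i assume "d \<le> i"
    then show "(if i < d \<and> enat (c * (k + 1)) \<le> u i then \<infinity> else u i) = 0"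
      using avoiding_support[OF u] by simp
  next
    fix x assume "x \<in> ?U k"
    then have "vec d (\<lambda>i. min (x $ i) (c * (k + 1))) \<in> ?U k"
    proof (rule backward_cov_truncate[OF N(1) t, rotated 2])
      show "t $ j \<le> c" if "j < d" for j using that by (rule c(1))
      show "a $ j \<le> c" if "(a, A, b) \<in> N" "j < d" for a A b j using that by (rule c(2))
    qed
    \<comment> \<open>This coordinate is below the threshold, so pumping leaves it alone, and it
      witnesses that \<open>x\<close> is avoided too.\<close>
    then obtain i where i: "i < d" "u i < enat (vec d (\<lambda>i. min (x $ i) (c * (k + 1))) $ i)"
      using u unfolding avoiding_def by blast
    then obtain m where "u i = enat m" by (cases "u i") auto
    then have "u i < enat (x $ i)" "\<not> enat (c * (k + 1)) \<le> u i" using i by auto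
    then show "\<exists>i<d. (if i < d \<and> enat (c * (k + 1)) \<le> u i then \<infinity> else u i) < enat (x $ i)"
      using i(1) by auto
  qed
  show "omegas d u < d" if "u \<in> avoiding d (?U k)"
    using that target_in_backward_cov[OF t] by (rule omegas_avoiding_less)
  show "\<exists>v. v \<in> avoiding d (?U k) \<and> v \<notin> avoiding d (?U (Suc k)) \<and> omegas d u \<le> omegas d v"
    if u: "u \<in> avoiding d (?U (Suc k))" "u \<notin> avoiding d (?U (Suc (Suc k)))"
  proof -
    have "\<forall>i\<ge>d. u i = 0" using avoiding_support[OF u(1)] by blast
    then obtain x where x: "x \<in> ?U (Suc (Suc k))" "\<And>i. i < d \<Longrightarrow> enat (x $ i) \<le> u i"
      using u(2) unfolding avoiding_def mem_Collect_eq not_less[symmetric] by blast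
    have "x \<notin> ?U (Suc k)" using u(1) not_avoidingI[OF _ x(2)] by blast
    then obtain y where y: "x \<in> carrier_vec d" "y \<in> ?U (Suc k)" "net_step N x y"
      using x(1) unfolding backward_cov.simps(2)[of d N t "Suc k"] pre_exists_def by blast
    then obtain a A b where aAb: "(a, A, b) \<in> N" "a \<le> x" "y = A *\<^sub>v (x - a) + b"
      unfolding net_step_def by auto
    then have car: "a \<in> carrier_vec d" "A \<in> carrier_mat d d" "b \<in> carrier_vec d"
      using N(1) by (auto simp: affine_net_def)
    have A: "invertible_mat (map_mat rat_of_nat A)"
      using N(2) aAb(1) by (auto simp: invertible_net_def)
    let ?v = "ideal_post d a A b u"
    have au: "enat (a $ j) \<le> u j" if "j < d" for j
    proof -
      have "a $ j \<le> x $ j" using aAb(2) that y(1) by (auto simp: less_eq_vec_def)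
      then show ?thesis using x(2)[OF that] by (meson enat_ord_simps(1) order_trans)
    qed
    have "?v \<notin> avoiding d (?U (Suc k))"
      using y(2) affine_le_ideal_post[OF car y(1) x(2)] unfolding aAb(3) by (rule not_avoidingI)
    \<comment> \<open>An element of \<open>?U k\<close> below \<open>?v\<close> would, by
      \<open>below_ideal_post\<close>, give some \<open>x'\<close> in the ideal of \<open>u\<close>
      with a step into \<open>?U k\<close>, so \<open>u\<close> would not avoid
      \<open>?U (Suc k)\<close>.\<close>
    moreover have "?v \<in> avoiding d (?U k)"
      unfolding avoiding_def mem_Collect_eq
    proof (intro conjI allI impI ballI)
      fix z assume z: "z \<in> ?U k"
      then have zc: "z \<in> carrier_vec d" using backward_cov_carrier by blast
      show "\<exists>i<d. ?v i < enat (z $ i)"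
      proof (rule ccontr)
        assume "\<not> ?thesis"
        then have le: "enat (z $ i) \<le> ?v i" if "i < d" for i
          using that not_le_imp_less by blast
        obtain x' where x': "x' \<in> carrier_vec d" "a \<le> x'" "\<And>j. j < d \<Longrightarrow> enat (x' $ j) \<le> u j"
          "z \<le> A *\<^sub>v (x' - a) + b"
          using below_ideal_post[OF car au zc le] by blast
        have step: "net_step N x' (A *\<^sub>v (x' - a) + b)"
          using aAb(1) x'(2) unfolding net_step_def by blast
        have "x' \<in> ?U (Suc k)"
          using backward_cov_upward[OF N(1) z x'(4) net_step_carrier[OF N(1) step]] step x'(1)
          by (auto simp: pre_exists_def)
        from not_avoidingI[OF this x'(3)] show False using u(1) by blast
      qed
    qed (simp add: ideal_post_def)
    ultimately show ?thesis using omegas_ideal_post[OF car A] by blast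
  qed
qed

text \<open>An upward closed set is determined by the ideals avoiding it: for a new element
  \<open>x\<close>, the ideal of all vectors below \<open>x\<close> avoids the old set but not the
  new one.\<close>

lemma backward_cov_stable:
  assumes "affine_net d N"
    and "avoiding d (backward_cov d N t k) \<subseteq> avoiding d (backward_cov d N t (Suc k))"
  shows "backward_cov d N t k = backward_cov d N t (Suc k)"
proof (rule ccontr)
  assume "\<not> ?thesis"
  then obtain x where x: "x \<in> backward_cov d N t (Suc k)" "x \<notin> backward_cov d N t k" by auto
  then have xc: "x \<in> carrier_vec d" using backward_cov_carrier by blast
  define u where "u = (\<lambda>i. if i < d then enat (x $ i) else 0)"
  have "\<exists>i<d. u i < enat (y $ i)" if y: "y \<in> backward_cov d N t k" for y
  proof (rule ccontr)
    assume "\<not> ?thesis"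
    then have "y $ i \<le> x $ i" if "i < d" for i
      using that unfolding u_def by (metis enat_ord_simps(2) not_less)
    moreover have "y \<in> carrier_vec d" using y backward_cov_carrier by blast
    ultimately have "y \<le> x" using xc by (simp add: less_eq_vec_def)
    from backward_cov_upward[OF assms(1) y this xc] show False using x(2) by contradiction
  qed
  moreover have "\<forall>i\<ge>d. u i = 0" by (simp add: u_def)
  ultimately have "u \<in> avoiding d (backward_cov d N t k)" unfolding avoiding_def by blast
  moreover have "u \<notin> avoiding d (backward_cov d N t (Suc k))"
    using x(1) by (rule not_avoidingI) (simp add: u_def)
  ultimately show False using assms(2) by blast
qed

section \<open>Solving the recurrence\<close>

text \<open>The exponents are bounded by a geometric sum; the extra \<open>n ^ 5\<close> supplies
  its missing last term, which makes the induction close.\<close>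

lemma prod_tower_le:
  fixes n :: nat
  assumes "n \<ge> 1" "i \<le> d"
  shows "n ^ 5 * (\<Prod>j\<in>{i<..d}. n ^ (5 * 2 ^ (d - j) - 1)) \<le> n ^ (5 * 2 ^ (d - i))"
  using assms(2)
proof (induction rule: inc_induct)
  case (step i)
  let ?e = "2 ^ (d - Suc i) :: nat"
  let ?P = "\<lambda>i. \<Prod>j\<in>{i<..d}. n ^ (5 * 2 ^ (d - j) - 1)"
  have "{i<..d} = insert (Suc i) {Suc i<..d}" using step.hyps by auto
  then have "n ^ 5 * ?P i = n ^ (5 * ?e - 1) * (n ^ 5 * ?P (Suc i))" by simp
  also have "\<dots> \<le> n ^ (5 * ?e - 1) * n ^ (5 * ?e)" using step.IH by (rule mult_le_mono2)
  also have "\<dots> = n ^ (5 * ?e - 1 + 5 * ?e)" by (rule power_add[symmetric])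
  also have "\<dots> \<le> n ^ (5 * 2 ^ (d - i))"
  proof -
    have "d - i = Suc (d - Suc i)" using step.hyps by simp
    then have "2 ^ (d - i) = 2 * ?e" by simp
    then show ?thesis using assms(1) by (intro power_increasing) auto
  qed
  finally show ?case .
qed simp

text \<open>Each factor is at most \<open>n ^ 3 * L j\<close>, as \<open>j \<le> n\<close> and
  \<open>L j + 1 \<le> n * L j\<close>; this turns the offset 4 into 1. With
  \<open>e = 2 ^ (d - Suc i)\<close>, both summands are then at most
  \<open>n ^ (10 * e - 5)\<close>, and one more factor \<open>n\<close> absorbs their sum.\<close>

lemma tower_recurrence:
  fixes n d i :: nat
  assumes n: "n \<ge> 2" "d \<le> n" "i < d"
  defines "L \<equiv> \<lambda>i. n ^ (5 * 2 ^ (d - i) - 4)"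
  shows "L (Suc i) + (\<Prod>j\<in>{i<..d}. j * (n * (L j + 1))) \<le> L i"
proof -
  let ?Q = "\<lambda>j. n ^ (5 * 2 ^ (d - j) - 1)"
  define e :: nat where "e = 2 ^ (d - Suc i)"
  have "d - i = Suc (d - Suc i)" using n by simp
  then have e: "1 \<le> e" "2 ^ (d - i) = 2 * e" by (simp_all add: e_def)
  have "j * (n * (L j + 1)) \<le> ?Q j" if j: "j \<in> {i<..d}" for j
  proof -
    have "1 \<le> L j" using n by (simp add: L_def)
    then have "L j + 1 \<le> 2 * L j" by simp
    also have "\<dots> \<le> n * L j" using n by simp
    finally have "j * (n * (L j + 1)) \<le> n * (n * (n * L j))"
      using n j by (intro mult_le_mono) auto
    also have "\<dots> = n ^ (3 + (5 * 2 ^ (d - j) - 4))"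
      by (simp add: L_def power_add power3_eq_cube mult.assoc)
    also have "3 + (5 * 2 ^ (d - j) - 4) = 5 * 2 ^ (d - j) - (1 :: nat)"
    proof -
      have "(1 :: nat) \<le> 2 ^ (d - j)" by simp
      then show ?thesis by linarith
    qed
    finally show ?thesis .
  qed
  then have "(\<Prod>j\<in>{i<..d}. j * (n * (L j + 1))) \<le> (\<Prod>j\<in>{i<..d}. ?Q j)"
    by (intro prod_mono) auto
  moreover have "(\<Prod>j\<in>{i<..d}. ?Q j) \<le> n ^ (10 * e - 5)"
  proof -
    have "n ^ 5 * (\<Prod>j\<in>{i<..d}. ?Q j) \<le> n ^ (5 + (10 * e - 5))"
      using prod_tower_le[of n i d] n e by simp
    then show ?thesis using n unfolding power_add by simp
  qed
  moreover have "L (Suc i) \<le> n ^ (10 * e - 5)"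
    unfolding L_def e_def[symmetric] using n e by (intro power_increasing) auto
  moreover have "2 * n ^ (10 * e - 5) \<le> L i"
  proof -
    have "2 * n ^ (10 * e - 5) \<le> n ^ Suc (10 * e - 5)" using n by simp
    also have "Suc (10 * e - 5) = 5 * 2 ^ (d - i) - 4" using e by simp
    finally show ?thesis by (simp add: L_def)
  qed
  ultimately show ?thesis by linarith
qed

section \<open>Input size and the final bound\<close>

lemma unary_size_bounds:
  assumes "affine_net d N" "t \<in> carrier_vec d"
  shows "d \<le> unary_size N t" "j < d \<Longrightarrow> t $ j \<le> unary_size N t"
    "(a, A, b) \<in> N \<Longrightarrow> j < d \<Longrightarrow> a $ j \<le> unary_size N t"
proof -
  have v: "v $ j \<le> unary_size_vec v" if "v \<in> carrier_vec d" "j < d" for v j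
  proof -
    have "v $ j + 1 \<le> unary_size_vec v"
      using that unfolding unary_size_vec_def by (intro member_le_sum) auto
    then show ?thesis by simp
  qed
  \<comment> \<open>The delimiters alone contribute \<open>d\<close>, even for a zero
    target.\<close>
  have "d \<le> unary_size_vec t" using assms(2) by (simp add: unary_size_vec_def sum_Suc)
  then show "d \<le> unary_size N t" by (simp add: unary_size_def)
  show "j < d \<Longrightarrow> t $ j \<le> unary_size N t"
    using v[OF assms(2), of j] by (simp add: unary_size_def)
  assume aj: "(a, A, b) \<in> N" "j < d"
  let ?f = "\<lambda>(a, A, b). unary_size_vec a + unary_size_mat A + unary_size_vec b"
  have "a \<in> carrier_vec d" "finite N" using assms(1) aj by (auto simp: affine_net_def)
  then have "a $ j \<le> ?f (a, A, b)" "?f (a, A, b) \<le> sum ?f N"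
    using v[of a j] aj by (simp, intro member_le_sum) auto
  then show "a $ j \<le> unary_size N t" unfolding unary_size_def by linarith
qed

theorem theorem4p12:
  shows "\<exists>f :: nat \<Rightarrow> nat. (\<lambda>d. real (f d)) \<in> O(\<lambda>d. real d) \<and>
    (\<forall>d \<ge> 2. \<forall>N. \<forall>t \<in> carrier_vec d. affine_net d N \<and> invertible_net N \<longrightarrow>
      backward_cov_terminates d N t \<and>
      backward_cov_iterations d N t \<le> unary_size N t ^ (2 ^ f d))"
proof (intro exI[of _ "\<lambda>d. d + 3"] conjI allI impI ballI)
  show "(\<lambda>d. real (d + 3)) \<in> O(\<lambda>d. real d)"
    by (rule bigoI[of _ 4]) (auto simp: eventually_sequentially intro!: exI[of _ 1])
next
  fix d :: nat and N and t :: "nat vec"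
  assume d: "2 \<le> d" and t: "t \<in> carrier_vec d" and N: "affine_net d N \<and> invertible_net N"
  let ?n = "unary_size N t"
  let ?L = "\<lambda>i. ?n ^ (5 * 2 ^ (d - i) - 4)"
  \<comment> \<open>The assumption \<open>2 \<le> d\<close> enters here, giving the base
    \<open>2 \<le> ?n\<close> for \<open>tower_recurrence\<close>.\<close>
  have n: "d \<le> ?n" "2 \<le> ?n" using unary_size_bounds(1)[OF _ t] N d by (auto intro: order_trans)
  interpret strongly_monotone_chain d "\<lambda>k. avoiding d (backward_cov d N t k)"
    "\<lambda>k. ?n * (k + 1)"
  proof (rule avoiding_backward_cov_chain)
    show "t $ j \<le> ?n" if "j < d" for j using N t that by (intro unary_size_bounds(2)) auto
    show "a $ j \<le> ?n" if "(a, A, b) \<in> N" "j < d" for a A b j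
      using N that by (intro unary_size_bounds(3)[OF _ t]) auto
  qed (use N t in auto)
  \<comment> \<open>For \<open>i = 0\<close>, an ideal lost at time \<open>?L 0\<close> would have
    fewer than 0 infinite components, so none is lost.\<close>
  have "avoiding d (backward_cov d N t (?L 0)) \<subseteq> avoiding d (backward_cov d N t (Suc (?L 0)))"
    using length_bound[of ?L 0 "?L 0"] tower_recurrence[OF n(2,1)] by auto
  then have eq: "backward_cov d N t (?L 0) = backward_cov d N t (Suc (?L 0))"
    using N by (intro backward_cov_stable) auto
  then show "backward_cov_terminates d N t" unfolding backward_cov_terminates_def by blast
  have "backward_cov_iterations d N t \<le> ?L 0"
    unfolding backward_cov_iterations_def by (rule Least_le) (rule eq)
  \<comment> \<open>The 3 in the exponent comes from
    \<open>5 * 2 ^ d - 4 \<le> 8 * 2 ^ d\<close>.\<close>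
  also have "\<dots> \<le> ?n ^ (2 ^ (d + 3))"
    using n by (intro power_increasing) (auto simp: power_add)
  finally show "backward_cov_iterations d N t \<le> ?n ^ (2 ^ (d + 3))" .
qed

end
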